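(* Let $\mathbb{F}$ be an arbitrary field (of any characteristic, including $2$), let $\mathcal{L}$ be a Lie algebra over $\mathbb{F}$ with $\dim_{\mathbb{F}}\mathcal{L}\leq 3$, and let $\mathcal{L}=\bigoplus_{g\in G}\mathcal{L}_g$ be any Lie grading on $\mathcal{L}$. Then there exist an abelian semigroup $(\Gamma,+)$ and an injective map $\iota\colon G\to\Gamma$ such that for any $g,g',g''\in G$ with $0\neq[\mathcal{L}_g,\mathcal{L}_{g'}]\subseteq\mathcal{L}_{g''}$, the equality $\iota(g)+\iota(g')=\iota(g'')$ holds in $\Gamma$.
   Context: A Lie grading on a Lie algebra $\mathcal{L}$ over a field $\mathbb{F}$ is a decomposition of $\mathcal{L}$ into a direct sum of subspaces $\mathcal{L}=\bigoplus_{g\in G}\mathcal{L}_g$ indexed by a set $G$, such that $\mathcal{L}_g\neq 0$ for every $g\in G$, and for any $g,g'\in G$ either $[\mathcal{L}_g,\mathcal{L}_{g'}]=0$ or there exists $g''\in G$ such that $0\neq[\mathcal{L}_g,\mathcal{L}_{g'}]\subseteq\mathcal{L}_{g''}$. Here $[\mathcal{L}_g,\mathcal{L}_{g'}]$ denotes the linear span of all brackets $[x,y]$ with $x\in\mathcal{L}_g$, $y\in\mathcal{L}_{g'}$. A Lie algebra over a field of any characteristic has an alternating bilinear bracket ($[x,x]=0$ for all $x$) satisfying the Jacobi identity. *)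

theory Defs
  imports Complex_Main
begin

locale lie_algebra = vector_space scale
  for scale :: "'k::field \<Rightarrow> 'v::ab_group_add \<Rightarrow> 'v" +
  fixes bracket :: "'v \<Rightarrow> 'v \<Rightarrow> 'v"
  assumes linear_left: "Vector_Spaces.linear scale scale (\<lambda>x. bracket x y)"
    and linear_right: "Vector_Spaces.linear scale scale (\<lambda>y. bracket x y)"
    and alternating: "bracket x x = 0"
    and jacobi: "bracket x (bracket y z) + bracket y (bracket z x) + bracket z (bracket x y) = 0"
begin

definition bracket_span :: "'v set \<Rightarrow> 'v set \<Rightarrow> 'v set"
  where "bracket_span A B = span {bracket x y | x y. x \<in> A \<and> y \<in> B}"

text \<open>Only the values \<open>V g\<close> with \<open>g \<in> G\<close> matter; decompositions are
  set to \<open>0\<close> outside \<open>G\<close>, so that uniqueness is uniqueness of the family indexed by \<open>G\<close>.\<close>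

definition direct_sum_decomposition :: "'g set \<Rightarrow> ('g \<Rightarrow> 'v set) \<Rightarrow> bool"
  where "direct_sum_decomposition G V \<longleftrightarrow>
    (\<forall>g\<in>G. subspace (V g)) \<and>
    (\<forall>x. \<exists>!f. (\<forall>g\<in>G. f g \<in> V g) \<and> (\<forall>g. g \<notin> G \<longrightarrow> f g = 0) \<and>
             finite {g. f g \<noteq> 0} \<and> x = (\<Sum>g | f g \<noteq> 0. f g))"

definition lie_grading :: "'g set \<Rightarrow> ('g \<Rightarrow> 'v set) \<Rightarrow> bool"
  where "lie_grading G V \<longleftrightarrow>
    direct_sum_decomposition G V \<and>
    (\<forall>g\<in>G. V g \<noteq> {0}) \<and>
    (\<forall>g\<in>G. \<forall>g'\<in>G. bracket_span (V g) (V g') = {0} \<or>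
       (\<exists>g''\<in>G. bracket_span (V g) (V g') \<noteq> {0} \<and> bracket_span (V g) (V g') \<subseteq> V g''))"

end

locale abelian_semigroup_on =
  fixes S :: "'s set" and add :: "'s \<Rightarrow> 's \<Rightarrow> 's"
  assumes nonempty: "S \<noteq> {}"
    and closed: "\<lbrakk>a \<in> S; b \<in> S\<rbrakk> \<Longrightarrow> add a b \<in> S"
    and assoc: "\<lbrakk>a \<in> S; b \<in> S; c \<in> S\<rbrakk> \<Longrightarrow> add (add a b) c = add a (add b c)"
    and commute: "\<lbrakk>a \<in> S; b \<in> S\<rbrakk> \<Longrightarrow> add a b = add b a"

end

(* Every homogeneous component has dimension at least 1, so there are at most three of them. A
   one-dimensional component squares to 0. With two components this leaves only products that embed
   into a semigroup with constant addition or into Z/2. With three components all are lines, and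
   the Jacobi identity for generators x, y, z excludes every pattern of products except those
   that embed into a semigroup with constant addition (all nonzero products in one component),
   the Klein four-group (each product in the third component), or Z/3 (one component is neutral and
   the other two multiply into it, as for sl_2). *)
theory Submission
  imports Defs
begin

section \<open>Embedding partial products into small abelian semigroups\<close>

text \<open>\<open>R g h k\<close> stands for "the product of components \<open>g\<close> and
  \<open>h\<close> is nonzero and lies in component \<open>k\<close>". Keeping \<open>R\<close>
  abstract separates the combinatorics of labels from the Lie algebra.\<close>

definition semigroup_embeddable :: "'g set \<Rightarrow> ('g \<Rightarrow> 'g \<Rightarrow> 'g \<Rightarrow> bool) \<Rightarrow> bool"
  where "semigroup_embeddable G R \<longleftrightarrow>
    (\<exists>(S :: nat set) add \<iota>. abelian_semigroup_on S add \<and> \<iota> ` G \<subseteq> S \<and> inj_on \<iota> G \<and>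
       (\<forall>g\<in>G. \<forall>h\<in>G. \<forall>k\<in>G. R g h k \<longrightarrow> add (\<iota> g) (\<iota> h) = \<iota> k))"

lemma semigroup_embeddableI:
  assumes "abelian_semigroup_on (UNIV :: nat set) add" "inj_on \<iota> G"
    and "\<And>g h k. \<lbrakk>g \<in> G; h \<in> G; k \<in> G; R g h k\<rbrakk> \<Longrightarrow> add (\<iota> g) (\<iota> h) = \<iota> k"
  shows "semigroup_embeddable G R"
  unfolding semigroup_embeddable_def using assms by blast

text \<open>A constant operation is associative and commutative, so any injective labelling works
  once its value is the label of \<open>e\<close>.\<close>

lemma semigroup_embeddable_constant:
  assumes "finite G" "\<And>g h k. \<lbrakk>g \<in> G; h \<in> G; k \<in> G; R g h k\<rbrakk> \<Longrightarrow> k = e"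
  shows "semigroup_embeddable G R"
proof -
  obtain \<iota> :: "'a \<Rightarrow> nat" where "inj_on \<iota> G"
    using finite_imp_inj_to_nat_seg[OF assms(1)] by blast
  moreover have "abelian_semigroup_on UNIV (\<lambda>_ _. \<iota> e)"
    by unfold_locales auto
  ultimately show ?thesis
    using assms(2) by (intro semigroup_embeddableI[where \<iota> = \<iota>]) auto
qed

lemma abelian_semigroup_on_xor: "abelian_semigroup_on UNIV (xor :: nat \<Rightarrow> nat \<Rightarrow> nat)"
  by unfold_locales (simp_all add: ac_simps)

text \<open>Associativity holds on all of \<open>nat\<close>, not only on residues: both bracketings
  of three summands reduce to their total mod \<open>n\<close>.\<close>

lemma abelian_semigroup_on_add_mod: "abelian_semigroup_on UNIV (\<lambda>x y :: nat. (x + y) mod n)"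
  by unfold_locales (auto simp: mod_simps ac_simps)

text \<open>The labels 1, 2, 3 are the nonzero elements of the Klein four-group under bitwise xor;
  two distinct ones add to the third, which is the only \<open>k\<close> that the hypothesis
  allows.\<close>

lemma semigroup_embeddable_Klein_four:
  assumes "a \<noteq> b" "a \<noteq> c" "b \<noteq> c"
    and "\<And>g h k. \<lbrakk>g \<in> {a, b, c}; h \<in> {a, b, c}; k \<in> {a, b, c}; R g h k\<rbrakk> \<Longrightarrow> g \<noteq> h \<and> k \<noteq> g \<and> k \<noteq> h"
  shows "semigroup_embeddable {a, b, c} R"
proof (rule semigroup_embeddableI[OF abelian_semigroup_on_xor])
  let ?\<iota> = "\<lambda>g. if g = a then 1 else if g = b then 2 else 3 :: nat"
  show "inj_on ?\<iota> {a, b, c}"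
    using assms(1-3) by (auto simp: inj_on_def)
  show "xor (?\<iota> g) (?\<iota> h) = ?\<iota> k"
    if "g \<in> {a, b, c}" "h \<in> {a, b, c}" "k \<in> {a, b, c}" "R g h k" for g h k
    using that(1-3) assms(4)[OF that] assms(1-3) by (elim insertE emptyE; simp)
qed

text \<open>In Z/3 the component \<open>a\<close> becomes neutral and \<open>b\<close>,
  \<open>c\<close> become mutually inverse. Squares are excluded by \<open>g \<noteq> h\<close>, so
  1 + 1 = 2 imposes nothing.\<close>

lemma semigroup_embeddable_mod3:
  assumes "a \<noteq> b" "a \<noteq> c" "b \<noteq> c"
    and "\<And>g h k. \<lbrakk>g \<in> {a, b, c}; h \<in> {a, b, c}; k \<in> {a, b, c}; R g h k\<rbrakk> \<Longrightarrow>
           g \<noteq> h \<and> (g = a \<longrightarrow> k = h) \<and> (h = a \<longrightarrow> k = g) \<and> (g \<noteq> a \<and> h \<noteq> a \<longrightarrow> k = a)"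
  shows "semigroup_embeddable {a, b, c} R"
proof (rule semigroup_embeddableI[OF abelian_semigroup_on_add_mod])
  let ?\<iota> = "\<lambda>g. if g = a then 0 else if g = b then 1 else 2 :: nat"
  show "inj_on ?\<iota> {a, b, c}"
    using assms(1-3) by (auto simp: inj_on_def)
  show "(?\<iota> g + ?\<iota> h) mod 3 = ?\<iota> k"
    if "g \<in> {a, b, c}" "h \<in> {a, b, c}" "k \<in> {a, b, c}" "R g h k" for g h k
    using that(1-3) assms(4)[OF that] assms(1-3) by (elim insertE emptyE; simp)
qed

lemma semigroup_embeddable_mod2:
  assumes "a \<noteq> b"
    and "\<And>g h k. \<lbrakk>g \<in> {a, b}; h \<in> {a, b}; k \<in> {a, b}; R g h k\<rbrakk> \<Longrightarrow>
           (g = a \<longrightarrow> k = h) \<and> (h = a \<longrightarrow> k = g) \<and> (g \<noteq> a \<and> h \<noteq> a \<longrightarrow> k = a)"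
  shows "semigroup_embeddable {a, b} R"
proof (rule semigroup_embeddableI[OF abelian_semigroup_on_add_mod])
  let ?\<iota> = "\<lambda>g. if g = a then 0 else 1 :: nat"
  show "inj_on ?\<iota> {a, b}"
    using assms(1) by (auto simp: inj_on_def)
  show "(?\<iota> g + ?\<iota> h) mod 2 = ?\<iota> k"
    if "g \<in> {a, b}" "h \<in> {a, b}" "k \<in> {a, b}" "R g h k" for g h k
    using that(1-3) assms(2)[OF that] assms(1) by (elim insertE emptyE; simp)
qed

text \<open>Only the pairs (a, b) and (b, b) can have an output, and each has at most one. Either
  all outputs agree, or the two differ, and then one of \<open>a\<close>, \<open>b\<close> acts as
  the neutral element of Z/2.\<close>

lemma semigroup_embeddable_two:
  assumes "a \<noteq> b"
    and R_sym: "\<And>g h k. R g h k \<Longrightarrow> R h g k"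
    and R_unique: "\<And>g h k k'. \<lbrakk>k \<in> {a, b}; k' \<in> {a, b}; R g h k; R g h k'\<rbrakk> \<Longrightarrow> k = k'"
    and no_square: "\<And>k. \<not> R a a k"
  shows "semigroup_embeddable {a, b} R"
proof (cases "\<exists>e. \<forall>g\<in>{a, b}. \<forall>h\<in>{a, b}. \<forall>k\<in>{a, b}. R g h k \<longrightarrow> k = e")
  case True
  then obtain e where e: "\<forall>g\<in>{a, b}. \<forall>h\<in>{a, b}. \<forall>k\<in>{a, b}. R g h k \<longrightarrow> k = e" ..
  show ?thesis by (rule semigroup_embeddable_constant[where e = e]) (use e in blast)+
next
  case False
  then have *: "\<exists>g\<in>{a, b}. \<exists>h\<in>{a, b}. \<exists>k\<in>{a, b}. R g h k \<and> k \<noteq> e" for e by blast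
  have sym: "R b a k \<longleftrightarrow> R a b k" for k using R_sym by blast
  \<comment> \<open>An output different from \<open>b\<close> must be \<open>a\<close>, and
    conversely, so both occur.\<close>
  have "R a b a \<or> R b b a" "R a b b \<or> R b b b"
    using *[of b] *[of a] by (auto simp: no_square sym)
  moreover have "\<not> (R g h a \<and> R g h b)" for g h
    using R_unique[of a b g h] assms(1) by auto
  ultimately consider "R a b a" "R b b b" "\<not> R a b b" "\<not> R b b a"
    | "R a b b" "R b b a" "\<not> R a b a" "\<not> R b b b"
    by blast
  then show ?thesis
  proof cases
    case 1
    have "semigroup_embeddable {b, a} R"
    proof (rule semigroup_embeddable_mod2)
      show "(g = b \<longrightarrow> k = h) \<and> (h = b \<longrightarrow> k = g) \<and> (g \<noteq> b \<and> h \<noteq> b \<longrightarrow> k = b)"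
        if "g \<in> {b, a}" "h \<in> {b, a}" "k \<in> {b, a}" "R g h k" for g h k
        using that 1 assms(1) by (elim insertE emptyE; simp add: no_square sym)
    qed (use assms(1) in simp)
    then show ?thesis by (simp add: insert_commute)
  next
    case 2
    show ?thesis
    proof (rule semigroup_embeddable_mod2)
      show "(g = a \<longrightarrow> k = h) \<and> (h = a \<longrightarrow> k = g) \<and> (g \<noteq> a \<and> h \<noteq> a \<longrightarrow> k = a)"
        if "g \<in> {a, b}" "h \<in> {a, b}" "k \<in> {a, b}" "R g h k" for g h k
        using that 2 assms(1) by (elim insertE emptyE; simp add: no_square sym)
    qed (use assms(1) in simp)
  qed
qed

text \<open>The five alternatives in \<open>cases\<close> correspond, in order, to constant
  addition, the Klein four-group, and Z/3 with neutral component \<open>a\<close>, \<open>b\<close>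
  or \<open>c\<close>. Nonzero values of \<open>A\<close>, \<open>B\<close>, \<open>C\<close> mark
  the possible outputs of the pairs (b, c), (c, a), (a, b).\<close>

lemma semigroup_embeddable_three:
  assumes distinct: "a \<noteq> b" "a \<noteq> c" "b \<noteq> c"
    and R: "\<And>g h k. \<lbrakk>R g h k; g \<in> {a, b, c}; h \<in> {a, b, c}; k \<in> {a, b, c}\<rbrakk> \<Longrightarrow>
      {g, h} = {b, c} \<and> A k \<noteq> 0 \<or> {g, h} = {c, a} \<and> B k \<noteq> 0 \<or> {g, h} = {a, b} \<and> C k \<noteq> 0"
    and cases: "(\<exists>e. \<forall>k. k \<noteq> e \<longrightarrow> A k = 0 \<and> B k = 0 \<and> C k = 0) \<or>
      (\<forall>k. (k \<noteq> a \<longrightarrow> A k = 0) \<and> (k \<noteq> b \<longrightarrow> B k = 0) \<and> (k \<noteq> c \<longrightarrow> C k = 0)) \<or>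
      (\<forall>k. (k \<noteq> a \<longrightarrow> A k = 0) \<and> (k \<noteq> c \<longrightarrow> B k = 0) \<and> (k \<noteq> b \<longrightarrow> C k = 0)) \<or>
      (\<forall>k. (k \<noteq> c \<longrightarrow> A k = 0) \<and> (k \<noteq> b \<longrightarrow> B k = 0) \<and> (k \<noteq> a \<longrightarrow> C k = 0)) \<or>
      (\<forall>k. (k \<noteq> b \<longrightarrow> A k = 0) \<and> (k \<noteq> a \<longrightarrow> B k = 0) \<and> (k \<noteq> c \<longrightarrow> C k = 0))"
  shows "semigroup_embeddable {a, b, c} R"
  using cases
proof (elim disjE)
  assume "\<exists>e. \<forall>k. k \<noteq> e \<longrightarrow> A k = 0 \<and> B k = 0 \<and> C k = 0"
  then obtain e where e: "\<forall>k. k \<noteq> e \<longrightarrow> A k = 0 \<and> B k = 0 \<and> C k = 0" ..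
  show ?thesis
  proof (rule semigroup_embeddable_constant)
    show "k = e" if "g \<in> {a, b, c}" "h \<in> {a, b, c}" "k \<in> {a, b, c}" "R g h k" for g h k
      using R[OF that(4,1-3)] spec[OF e, of k] by blast
  qed simp
next
  assume H: "\<forall>k. (k \<noteq> a \<longrightarrow> A k = 0) \<and> (k \<noteq> b \<longrightarrow> B k = 0) \<and> (k \<noteq> c \<longrightarrow> C k = 0)"
  show ?thesis
  proof (rule semigroup_embeddable_Klein_four[OF distinct])
    show "g \<noteq> h \<and> k \<noteq> g \<and> k \<noteq> h"
      if "g \<in> {a, b, c}" "h \<in> {a, b, c}" "k \<in> {a, b, c}" "R g h k" for g h k
      using R[OF that(4,1-3)] spec[OF H, of k] distinct unfolding doubleton_eq_iff
      by (elim disjE conjE; simp)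
  qed
next
  assume H: "\<forall>k. (k \<noteq> a \<longrightarrow> A k = 0) \<and> (k \<noteq> c \<longrightarrow> B k = 0) \<and> (k \<noteq> b \<longrightarrow> C k = 0)"
  show ?thesis
  proof (rule semigroup_embeddable_mod3[OF distinct])
    show "g \<noteq> h \<and> (g = a \<longrightarrow> k = h) \<and> (h = a \<longrightarrow> k = g) \<and> (g \<noteq> a \<and> h \<noteq> a \<longrightarrow> k = a)"
      if "g \<in> {a, b, c}" "h \<in> {a, b, c}" "k \<in> {a, b, c}" "R g h k" for g h k
      using R[OF that(4,1-3)] spec[OF H, of k] distinct unfolding doubleton_eq_iff
      by (elim disjE conjE; simp)
  qed
next
  assume H: "\<forall>k. (k \<noteq> c \<longrightarrow> A k = 0) \<and> (k \<noteq> b \<longrightarrow> B k = 0) \<and> (k \<noteq> a \<longrightarrow> C k = 0)"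
  have perm: "{b, a, c} = {a, b, c}" by (rule insert_commute)
  have "semigroup_embeddable {b, a, c} R"
  proof (rule semigroup_embeddable_mod3)
    show "g \<noteq> h \<and> (g = b \<longrightarrow> k = h) \<and> (h = b \<longrightarrow> k = g) \<and> (g \<noteq> b \<and> h \<noteq> b \<longrightarrow> k = b)"
      if "g \<in> {b, a, c}" "h \<in> {b, a, c}" "k \<in> {b, a, c}" "R g h k" for g h k
      using R[OF that(4,1-3)[unfolded perm]] spec[OF H, of k] distinct unfolding doubleton_eq_iff
      by (elim disjE conjE; simp)
  qed (use distinct in simp_all)
  then show ?thesis unfolding perm .
next
  assume H: "\<forall>k. (k \<noteq> b \<longrightarrow> A k = 0) \<and> (k \<noteq> a \<longrightarrow> B k = 0) \<and> (k \<noteq> c \<longrightarrow> C k = 0)"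
  have perm: "{c, a, b} = {a, b, c}" by blast
  have "semigroup_embeddable {c, a, b} R"
  proof (rule semigroup_embeddable_mod3)
    show "g \<noteq> h \<and> (g = c \<longrightarrow> k = h) \<and> (h = c \<longrightarrow> k = g) \<and> (g \<noteq> c \<and> h \<noteq> c \<longrightarrow> k = c)"
      if "g \<in> {c, a, b}" "h \<in> {c, a, b}" "k \<in> {c, a, b}" "R g h k" for g h k
      using R[OF that(4,1-3)[unfolded perm]] spec[OF H, of k] distinct unfolding doubleton_eq_iff
      by (elim disjE conjE; simp)
  qed (use distinct in simp_all)
  then show ?thesis unfolding perm .
qed

section \<open>The Jacobi identity for three homogeneous lines\<close>

text \<open>Here \<open>p\<close>, \<open>q\<close>, \<open>r\<close> are the degrees of the three
  brackets of basis vectors and \<alpha>, \<beta>, \<gamma> their coefficients. There are 27 choices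
  of degrees; in each, the equations are quadratic in the coefficients and a field has no zero
  divisors. For instance, the cyclic choice \<open>p = b\<close>, \<open>q = c\<close>,
  \<open>r = a\<close> makes all pairwise products vanish, so at most one bracket survives.\<close>

lemma jacobi_monomial_coefficients:
  fixes \<alpha> \<beta> \<gamma> :: "'k::field"
  assumes d: "a \<noteq> b" "a \<noteq> c" "b \<noteq> c"
    and pqr: "p \<in> {a, b, c}" "q \<in> {a, b, c}" "r \<in> {a, b, c}"
    and j: "\<And>k. k \<in> {a, b, c} \<Longrightarrow> ((if b = p then \<alpha> else 0) - (if a = q then \<beta> else 0)) * (if k = r then \<gamma> else 0)
   + ((if a = r then \<gamma> else 0) - (if c = p then \<alpha> else 0)) * (if k = q then \<beta> else 0)
   + ((if c = q then \<beta> else 0) - (if b = r then \<gamma> else 0)) * (if k = p then \<alpha> else 0) = 0"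
  shows "(\<exists>e. (p = e \<or> \<alpha> = 0) \<and> (q = e \<or> \<beta> = 0) \<and> (r = e \<or> \<gamma> = 0)) \<or>
    (p = a \<or> \<alpha> = 0) \<and> (q = b \<or> \<beta> = 0) \<and> (r = c \<or> \<gamma> = 0) \<or>
    (p = a \<or> \<alpha> = 0) \<and> (q = c \<or> \<beta> = 0) \<and> (r = b \<or> \<gamma> = 0) \<or>
    (p = c \<or> \<alpha> = 0) \<and> (q = b \<or> \<beta> = 0) \<and> (r = a \<or> \<gamma> = 0) \<or>
    (p = b \<or> \<alpha> = 0) \<and> (q = a \<or> \<beta> = 0) \<and> (r = c \<or> \<gamma> = 0)"
  using pqr j[of a] j[of b] j[of c]
  apply (elim insertE emptyE)
  apply (simp_all only: d d[symmetric] if_True if_False simp_thms insert_iff mult_zero_left mult_zero_right add_0_left add_0_right diff_0 diff_0_right diff_zero)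
  apply (simp_all add: algebra_simps)
  apply auto
  done

text \<open>\<open>A\<close>, \<open>B\<close>, \<open>C\<close> are the coordinates of \<open>[y, z]\<close>, \<open>[z, x]\<close>, \<open>[x, y]\<close> in a homogeneous basis
  \<open>x, y, z\<close> of degrees \<open>a, b, c\<close>; the hypothesis \<open>jacobi\<close> is the \<open>k\<close>-coordinate of the Jacobi identity.\<close>
lemma jacobi_structure_constants:
  fixes A B C :: "'g \<Rightarrow> 'k::field"
  assumes distinct: "a \<noteq> b" "a \<noteq> c" "b \<noteq> c"
    and A: "\<And>k. k \<noteq> p \<Longrightarrow> A k = 0" and B: "\<And>k. k \<noteq> q \<Longrightarrow> B k = 0" and C: "\<And>k. k \<noteq> r \<Longrightarrow> C k = 0"
    and pqr: "p \<in> {a, b, c}" "q \<in> {a, b, c}" "r \<in> {a, b, c}"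
    and jacobi: "\<And>k. k \<in> {a, b, c} \<Longrightarrow>
      (A b - B a) * C k + (C a - A c) * B k + (B c - C b) * A k = 0"
  shows "(\<exists>e. \<forall>k. k \<noteq> e \<longrightarrow> A k = 0 \<and> B k = 0 \<and> C k = 0) \<or>
    (\<forall>k. (k \<noteq> a \<longrightarrow> A k = 0) \<and> (k \<noteq> b \<longrightarrow> B k = 0) \<and> (k \<noteq> c \<longrightarrow> C k = 0)) \<or>
    (\<forall>k. (k \<noteq> a \<longrightarrow> A k = 0) \<and> (k \<noteq> c \<longrightarrow> B k = 0) \<and> (k \<noteq> b \<longrightarrow> C k = 0)) \<or>
    (\<forall>k. (k \<noteq> c \<longrightarrow> A k = 0) \<and> (k \<noteq> b \<longrightarrow> B k = 0) \<and> (k \<noteq> a \<longrightarrow> C k = 0)) \<or>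
    (\<forall>k. (k \<noteq> b \<longrightarrow> A k = 0) \<and> (k \<noteq> a \<longrightarrow> B k = 0) \<and> (k \<noteq> c \<longrightarrow> C k = 0))"
proof -
  \<comment> \<open>Each of \<open>A\<close>, \<open>B\<close>, \<open>C\<close> has at most one
    nonzero value, so a position and a coefficient determine it; this reduces the claim to finitely
    many cases.\<close>
  define \<alpha> \<beta> \<gamma> where "\<alpha> = A p" and "\<beta> = B q" and "\<gamma> = C r"
  have A': "A = (\<lambda>k. if k = p then \<alpha> else 0)" and B': "B = (\<lambda>k. if k = q then \<beta> else 0)"
    and C': "C = (\<lambda>k. if k = r then \<gamma> else 0)"
    using A B C by (auto simp: \<alpha>_def \<beta>_def \<gamma>_def)
  have support: "(\<forall>k. k \<noteq> e \<longrightarrow> (if k = d then x else 0) = 0) \<longleftrightarrow> d = e \<or> x = 0"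
    for d e :: 'g and x :: 'k
    by auto
  have "(\<exists>e. (p = e \<or> \<alpha> = 0) \<and> (q = e \<or> \<beta> = 0) \<and> (r = e \<or> \<gamma> = 0)) \<or>
    (p = a \<or> \<alpha> = 0) \<and> (q = b \<or> \<beta> = 0) \<and> (r = c \<or> \<gamma> = 0) \<or>
    (p = a \<or> \<alpha> = 0) \<and> (q = c \<or> \<beta> = 0) \<and> (r = b \<or> \<gamma> = 0) \<or>
    (p = c \<or> \<alpha> = 0) \<and> (q = b \<or> \<beta> = 0) \<and> (r = a \<or> \<gamma> = 0) \<or>
    (p = b \<or> \<alpha> = 0) \<and> (q = a \<or> \<beta> = 0) \<and> (r = c \<or> \<gamma> = 0)"
    using jacobi unfolding A' B' C' by (rule jacobi_monomial_coefficients[OF distinct pqr])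
  then show ?thesis
    unfolding A' B' C' imp_conjR all_conj_distrib support .
qed

section \<open>Brackets of homogeneous components\<close>

locale fd_lie_grading =
  lie_algebra scale bracket + finite_dimensional_vector_space scale Basis
  for scale :: "'k::field \<Rightarrow> 'v::ab_group_add \<Rightarrow> 'v"
    and bracket :: "'v \<Rightarrow> 'v \<Rightarrow> 'v"
    and Basis :: "'v set" +
  fixes G :: "'g set" and V :: "'g \<Rightarrow> 'v set"
  assumes grading: "lie_grading G V"
begin

lemma bracket_zero [simp]: "bracket 0 x = 0" "bracket x 0 = 0"
  using module_hom.zero[OF linear_left[unfolded linear_iff_module_hom]]
    module_hom.zero[OF linear_right[unfolded linear_iff_module_hom]] by auto

lemma bracket_add: "bracket (x + y) z = bracket x z + bracket y z" "bracket x (y + z) = bracket x y + bracket x z"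
  using module_hom.add[OF linear_left[unfolded linear_iff_module_hom]]
    module_hom.add[OF linear_right[unfolded linear_iff_module_hom]] by auto

lemma bracket_scale: "bracket (scale r x) y = scale r (bracket x y)" "bracket x (scale r y) = scale r (bracket x y)"
  using module_hom.scale[OF linear_left[unfolded linear_iff_module_hom]]
    module_hom.scale[OF linear_right[unfolded linear_iff_module_hom]] by auto

lemma bracket_skew: "bracket y x = - bracket x y"
proof -
  have "bracket (x + y) (x + y) = 0" by (rule alternating)
  then have "bracket x y + bracket y x = 0"
    unfolding bracket_add by (simp add: alternating add.commute)
  then show ?thesis by (simp add: eq_neg_iff_add_eq_0 add.commute)
qed

definition product_in :: "'g \<Rightarrow> 'g \<Rightarrow> 'g \<Rightarrow> bool"
  where "product_in g h k \<longleftrightarrow> bracket_span (V g) (V h) \<noteq> {0} \<and> bracket_span (V g) (V h) \<subseteq> V k"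

lemma subspace_V: "g \<in> G \<Longrightarrow> subspace (V g)"
  using grading unfolding lie_grading_def direct_sum_decomposition_def by blast

lemma bracket_in_bracket_span: "\<lbrakk>x \<in> A; y \<in> B\<rbrakk> \<Longrightarrow> bracket x y \<in> bracket_span A B"
  unfolding bracket_span_def by (rule span_base) blast

lemma bracket_span_eq_0: "(\<And>x y. \<lbrakk>x \<in> A; y \<in> B\<rbrakk> \<Longrightarrow> bracket x y = 0) \<Longrightarrow> bracket_span A B = {0}"
  unfolding bracket_span_def
  by (rule subset_antisym, rule span_minimal) (auto simp: subspace_0 span_0 subspace_single_0)

lemma bracket_span_commute: "bracket_span B A = bracket_span A B"
proof -
  have "bracket_span B A \<subseteq> bracket_span A B" for A B
    unfolding bracket_span_def[of B A]
  proof (rule span_minimal)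
    show "subspace (bracket_span A B)"
      unfolding bracket_span_def by (rule subspace_span)
    then have "bracket x y \<in> bracket_span A B" if "x \<in> B" "y \<in> A" for x y
      unfolding bracket_skew[of x y] using that by (intro subspace_neg bracket_in_bracket_span)
    then show "{bracket x y |x y. x \<in> B \<and> y \<in> A} \<subseteq> bracket_span A B" by blast
  qed
  then show ?thesis by blast
qed

lemma product_in_sym: "product_in g h k \<Longrightarrow> product_in h g k"
  unfolding product_in_def by (metis bracket_span_commute)

lemma product_in_bracket: "\<lbrakk>product_in g h k; x \<in> V g; y \<in> V h\<rbrakk> \<Longrightarrow> bracket x y \<in> V k"
  unfolding product_in_def using bracket_in_bracket_span by blast

lemma product_in_nonzero:
  assumes "product_in g h k" obtains x y where "x \<in> V g" "y \<in> V h" "bracket x y \<noteq> 0"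
  using assms bracket_span_eq_0 unfolding product_in_def by metis

text \<open>A vanishing product lies in every component, so zero and nonzero products can be treated
  alike.\<close>

lemma bracket_component:
  assumes "g \<in> G" "h \<in> G"
  obtains k where "k \<in> G" "\<And>x y. \<lbrakk>x \<in> V g; y \<in> V h\<rbrakk> \<Longrightarrow> bracket x y \<in> V k"
proof -
  have "bracket_span (V g) (V h) = {0} \<or> (\<exists>k\<in>G. bracket_span (V g) (V h) \<subseteq> V k)"
    using grading assms unfolding lie_grading_def by meson
  \<comment> \<open>If the product is zero, \<open>g\<close> itself serves as
    \<open>k\<close>.\<close>
  then obtain k where k: "k \<in> G" "bracket_span (V g) (V h) \<subseteq> V k"
    using subspace_0[OF subspace_V[OF assms(1)]] assms(1) by auto
  show ?thesis
  proof (rule that[OF k(1)])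
    show "bracket x y \<in> V k" if "x \<in> V g" "y \<in> V h" for x y
      using bracket_in_bracket_span[OF that] k(2) by (rule subsetD[rotated])
  qed
qed

section \<open>Independence and dimensions of the components\<close>

text \<open>Extending both families by 0 outside \<open>F\<close> brings them under the uniqueness
  clause of the direct sum, which speaks of families on the whole index type summed over their
  supports.\<close>

lemma decomposition_unique:
  assumes "finite F" "F \<subseteq> G" "\<And>g. g \<in> F \<Longrightarrow> f g \<in> V g" "\<And>g. g \<in> F \<Longrightarrow> f' g \<in> V g"
    and "(\<Sum>g\<in>F. f g) = (\<Sum>g\<in>F. f' g)" "g \<in> F"
  shows "f g = f' g"
proof -
  define ext where "ext f g = (if g \<in> F then f g else 0)" for f :: "'g \<Rightarrow> 'v" and g
  define D where "D x f \<longleftrightarrow> (\<forall>g\<in>G. f g \<in> V g) \<and> (\<forall>g. g \<notin> G \<longrightarrow> f g = 0) \<and>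
      finite {g. f g \<noteq> 0} \<and> x = (\<Sum>g | f g \<noteq> 0. f g)" for x f
  have ext: "D (\<Sum>g\<in>F. f g) (ext f)" if "\<And>g. g \<in> F \<Longrightarrow> f g \<in> V g" for f
    unfolding D_def
  proof (intro conjI)
    show "\<forall>g\<in>G. ext f g \<in> V g"
      using that subspace_0[OF subspace_V] by (simp add: ext_def)
    show "\<forall>g. g \<notin> G \<longrightarrow> ext f g = 0"
      using assms(2) by (auto simp: ext_def)
    have sub: "{g. ext f g \<noteq> 0} \<subseteq> F" by (auto simp: ext_def)
    then show "finite {g. ext f g \<noteq> 0}" using assms(1) finite_subset by blast
    have "(\<Sum>g | ext f g \<noteq> 0. ext f g) = (\<Sum>g\<in>F. ext f g)"
      using sub assms(1) by (intro sum.mono_neutral_left) auto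
    then show "(\<Sum>g\<in>F. f g) = (\<Sum>g | ext f g \<noteq> 0. ext f g)"
      by (simp add: ext_def)
  qed
  have "\<forall>x. \<exists>!f. D x f"
    using grading unfolding lie_grading_def direct_sum_decomposition_def D_def by (elim conjE)
  moreover have "D (\<Sum>g\<in>F. f g) (ext f)" "D (\<Sum>g\<in>F. f g) (ext f')"
    using ext[of f] ext[of f'] assms(3,4) unfolding assms(5) by blast+
  ultimately have "ext f = ext f'" by blast
  then have "ext f g = ext f' g" by simp
  then show ?thesis
    using assms(6) by (simp add: ext_def)
qed

lemma V_Int:
  assumes "g \<in> G" "h \<in> G" "g \<noteq> h" "x \<in> V g" "x \<in> V h"
  shows "x = 0"
proof -
  \<comment> \<open>The vector \<open>x\<close> placed in degree \<open>g\<close> and the same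
    vector placed in degree \<open>h\<close> are two families with equal sum; their values at
    \<open>g\<close> are \<open>x\<close> and 0.\<close>
  have "(if g = g then x else 0) = (if g = h then x else 0)"
  proof (rule decomposition_unique[of "{g, h}" "\<lambda>k. if k = g then x else 0" "\<lambda>k. if k = h then x else 0" g])
    show "(if k = g then x else 0) \<in> V k" "(if k = h then x else 0) \<in> V k" if "k \<in> {g, h}" for k
      using that assms subspace_0[OF subspace_V[of k]] by auto
  qed (use assms in auto)
  then show ?thesis using assms(3) by simp
qed

lemma product_in_unique:
  assumes "k \<in> G" "k' \<in> G" "product_in g h k" "product_in g h k'"
  shows "k = k'"
  using assms V_Int product_in_nonzero product_in_bracket by metis

lemma V_nonzero:
  assumes "g \<in> G" obtains x where "x \<in> V g" "x \<noteq> 0"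
proof -
  have "V g \<noteq> {0}" using grading assms unfolding lie_grading_def by blast
  then show ?thesis using subspace_0[OF subspace_V[OF assms]] that by blast
qed

lemma dim_V_pos: "g \<in> G \<Longrightarrow> dim (V g) > 0"
  using V_nonzero[of g] dim_eq_0[of "V g"] by (metis neq0_conv singletonD subset_iff)

text \<open>The components in \<open>F\<close> are independent, so the dimension of their sum
  \<open>W F\<close> is the sum of their dimensions; this follows by adding one component at a
  time.\<close>

lemma sum_dim_V_le:
  assumes "finite F" "F \<subseteq> G"
  shows "(\<Sum>g\<in>F. dim (V g)) \<le> dim UNIV"
proof -
  define W where "W F = {\<Sum>g\<in>F. f g |f. \<forall>g\<in>F. f g \<in> V g}" for F
  have "subspace (W F) \<and> dim (W F) = (\<Sum>g\<in>F. dim (V g))"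
    using assms
  proof (induction F)
    case empty
    then show ?case by (simp add: W_def dim_eq_0 subspace_single_0)
  next
    case (insert g F)
    have g: "g \<in> G" "subspace (V g)" using insert.prems subspace_V by auto
    have *: "W (insert g F) = {x + y |x y. x \<in> V g \<and> y \<in> W F}" (is "?l = ?r")
    proof
      show "?l \<subseteq> ?r" using insert.hyps unfolding W_def by auto
      show "?r \<subseteq> ?l"
      proof
        fix v assume "v \<in> ?r"
        then obtain x f where v: "v = x + (\<Sum>g\<in>F. f g)" "x \<in> V g" "\<forall>g\<in>F. f g \<in> V g"
          unfolding W_def by blast
        have "(\<Sum>h\<in>F. (f(g := x)) h) = (\<Sum>h\<in>F. f h)"
          using insert.hyps by (intro sum.cong) auto
        then have "v = (\<Sum>h\<in>insert g F. (f(g := x)) h)"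
          using insert.hyps v(1) by simp
        moreover have "\<forall>h\<in>insert g F. (f(g := x)) h \<in> V h"
          using v by auto
        ultimately show "v \<in> ?l" unfolding W_def by blast
      qed
    qed
    \<comment> \<open>A common vector has two decompositions over \<open>insert g F\<close>, one
      concentrated at \<open>g\<close> and one vanishing at \<open>g\<close>; uniqueness makes it
      0.\<close>
    have "V g \<inter> W F = {0}"
    proof
      show "V g \<inter> W F \<subseteq> {0}"
      proof
        fix x assume "x \<in> V g \<inter> W F"
        then obtain f where x: "x \<in> V g" "x = (\<Sum>g\<in>F. f g)" "\<forall>g\<in>F. f g \<in> V g"
          unfolding W_def by blast
        have "(\<Sum>h\<in>F. if h = g then 0 else f h) = (\<Sum>h\<in>F. f h)"
          using insert.hyps by (intro sum.cong) auto
        then have eq: "(\<Sum>h\<in>insert g F. if h = g then x else 0) = (\<Sum>h\<in>insert g F. if h = g then 0 else f h)"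
          using insert.hyps x(2) by simp
        have "(if g = g then x else 0) = (if g = g then 0 else f g)"
        proof (rule decomposition_unique[of "insert g F" "\<lambda>h. if h = g then x else 0"
              "\<lambda>h. if h = g then 0 else f h" g])
          show "(if h = g then x else 0) \<in> V h" "(if h = g then 0 else f h) \<in> V h" if "h \<in> insert g F" for h
            using that x insert.prems subspace_0[OF subspace_V[of h]] by auto
        qed (use insert.hyps insert.prems eq in auto)
        then show "x \<in> {0}" by simp
      qed
      show "{0} \<subseteq> V g \<inter> W F"
        using g insert by (auto intro: subspace_0)
    qed
    then have "dim (W (insert g F)) = dim (V g) + dim (W F)"
      using dim_sums_Int[OF g(2), of "W F"] insert unfolding * by simp
    moreover have "subspace (W (insert g F))"
      unfolding * using g insert by (intro subspace_sums) auto
    ultimately show ?case using insert by simp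
  qed
  then show ?thesis using dim_subset_UNIV[of "W F"] by (simp add: dimension_def)
qed

lemma V_eq_multiples:
  assumes "g \<in> G" "dim (V g) \<le> 1" "v \<in> V g" "v \<noteq> 0" "x \<in> V g"
  obtains r where "x = scale r v"
proof -
  have "V g \<subseteq> span {v}"
    using assms dim_V_pos[OF assms(1)] by (intro card_ge_dim_independent) auto
  then show ?thesis using assms(5) that by (auto simp: span_singleton)
qed

text \<open>On a line any two vectors are proportional, and the alternating law kills their bracket
  in every characteristic, including 2.\<close>

lemma dim_ge_2_of_square:
  assumes "g \<in> G" "product_in g g k"
  shows "dim (V g) \<ge> 2"
proof (rule ccontr)
  assume "\<not> dim (V g) \<ge> 2"
  then have d: "dim (V g) \<le> 1" by simp
  obtain x y where xy: "x \<in> V g" "y \<in> V g" "bracket x y \<noteq> 0"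
    using assms product_in_nonzero by blast
  then have "x \<noteq> 0" by auto
  then obtain r where "y = scale r x"
    using V_eq_multiples[OF assms(1) d] xy by blast
  then show False using xy by (simp add: bracket_scale alternating)
qed

section \<open>Gradings with two or three components\<close>

text \<open>In total dimension at most 3 one of the two components is a line; having no square, it
  takes the role of \<open>a\<close> in \<open>semigroup_embeddable_two\<close>.\<close>

lemma semigroup_embeddable_card_2:
  assumes "G = {a, b}" "a \<noteq> b" "dim UNIV \<le> 3"
  shows "semigroup_embeddable G product_in"
proof -
  have unique: "k = k'" if "k \<in> {a, b}" "k' \<in> {a, b}" "product_in g h k" "product_in g h k'" for g h k k'
    using product_in_unique that assms(1) by blast
  have "dim (V a) + dim (V b) \<le> 3"
    using sum_dim_V_le[of "{a, b}"] assms by simp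
  then have "dim (V a) < 2 \<or> dim (V b) < 2" by linarith
  then consider "\<And>k. \<not> product_in a a k" | "\<And>k. \<not> product_in b b k"
    using dim_ge_2_of_square[of a] dim_ge_2_of_square[of b] assms(1)
    by (metis insertI1 insertI2 not_le)
  then show ?thesis
  proof cases
    case 1
    show ?thesis
      unfolding assms(1)
      by (rule semigroup_embeddable_two[OF assms(2)]) (fact product_in_sym unique 1)+
  next
    case 2
    have "semigroup_embeddable {b, a} product_in"
      by (rule semigroup_embeddable_two[OF assms(2)[symmetric]])
        (fact product_in_sym unique[unfolded insert_commute[of a b "{}"]] 2)+
    then show ?thesis by (simp add: assms(1) insert_commute)
  qed
qed

text \<open>All components are lines, so one generator of each turns the grading into structure
  constants to which the Jacobi case analysis applies.\<close>

lemma semigroup_embeddable_card_3: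
  assumes G: "G = {a, b, c}" and distinct: "a \<noteq> b" "a \<noteq> c" "b \<noteq> c" and "dim UNIV \<le> 3"
  shows "semigroup_embeddable G product_in"
proof -
  have "dim (V a) + dim (V b) + dim (V c) \<le> 3"
    using sum_dim_V_le[of "{a, b, c}"] assms by simp
  then have dim1: "dim (V g) \<le> 1" if "g \<in> G" for g
    using that G dim_V_pos[of a] dim_V_pos[of b] dim_V_pos[of c] by auto
  have "\<forall>g\<in>G. \<exists>x. x \<in> V g \<and> x \<noteq> 0" using V_nonzero by blast
  then obtain v where v: "\<And>g. g \<in> G \<Longrightarrow> v g \<in> V g \<and> v g \<noteq> 0" by metis
  \<comment> \<open>Each bracket of generators is a multiple of a single \<open>v p\<close>. Writing
    it with all three coordinates lets the Jacobi identity be expanded uniformly, whatever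
    \<open>p\<close> is.\<close>
  have "\<exists>p A. p \<in> G \<and> (\<forall>k. k \<noteq> p \<longrightarrow> A k = 0) \<and>
      bracket (v g) (v h) = scale (A a) (v a) + scale (A b) (v b) + scale (A c) (v c)"
    if gh: "g \<in> G" "h \<in> G" for g h
  proof -
    obtain p where p: "p \<in> G" "bracket (v g) (v h) \<in> V p"
      using bracket_component[OF gh] v gh by metis
    obtain r where r: "bracket (v g) (v h) = scale r (v p)"
      using V_eq_multiples[OF p(1) dim1] v p by metis
    show ?thesis
      using p(1) distinct unfolding r G
      by (intro exI[of _ p] exI[of _ "\<lambda>k. if k = p then r else 0"]) auto
  qed
  note expand = this
  \<comment> \<open>A nonzero bracket of arbitrary elements of two lines forces a nonzero bracket of
    their generators; lying in both \<open>V p\<close> and \<open>V k\<close>, it gives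
    \<open>p = k\<close>.\<close>
  have coeffs: "A k \<noteq> 0 \<and> (\<forall>l. l \<noteq> k \<longrightarrow> A l = 0)"
    if gh_k: "product_in g h k" and ghk: "g \<in> G" "h \<in> G" "k \<in> G" and p: "p \<in> G" "\<forall>l. l \<noteq> p \<longrightarrow> A l = 0"
      "bracket (v g) (v h) = scale (A a) (v a) + scale (A b) (v b) + scale (A c) (v c)"
    for g h k p A
  proof -
    obtain x y where xy: "x \<in> V g" "y \<in> V h" "bracket x y \<noteq> 0"
      using product_in_nonzero[OF gh_k] by blast
    obtain r where "x = scale r (v g)"
      using V_eq_multiples[OF ghk(1) dim1[OF ghk(1)]] v ghk xy(1) by metis
    moreover obtain s where "y = scale s (v h)"
      using V_eq_multiples[OF ghk(2) dim1[OF ghk(2)]] v ghk xy(2) by metis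
    ultimately have nz: "bracket (v g) (v h) \<noteq> 0"
      using xy(3) by (auto simp: bracket_scale)
    have eq: "bracket (v g) (v h) = scale (A p) (v p)"
      using p G distinct by auto
    then have Ap: "A p \<noteq> 0" using nz by auto
    have "bracket (v g) (v h) \<in> V p"
      unfolding eq using v[OF p(1)] subspace_V[OF p(1)] by (auto intro: subspace_scale)
    moreover have "bracket (v g) (v h) \<in> V k"
      using product_in_bracket[OF gh_k] v ghk by auto
    ultimately have "p = k" using V_Int[OF p(1) ghk(3)] nz by auto
    then show ?thesis using Ap p(2) by auto
  qed
  have abc: "a \<in> G" "b \<in> G" "c \<in> G" using G by auto
  obtain p A where A: "p \<in> G" "\<forall>k. k \<noteq> p \<longrightarrow> A k = 0"
    "bracket (v b) (v c) = scale (A a) (v a) + scale (A b) (v b) + scale (A c) (v c)"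
    using expand[OF abc(2,3)] by auto
  obtain q B where B: "q \<in> G" "\<forall>k. k \<noteq> q \<longrightarrow> B k = 0"
    "bracket (v c) (v a) = scale (B a) (v a) + scale (B b) (v b) + scale (B c) (v c)"
    using expand[OF abc(3,1)] by auto
  obtain r C where C: "r \<in> G" "\<forall>k. k \<noteq> r \<longrightarrow> C k = 0"
    "bracket (v a) (v b) = scale (C a) (v a) + scale (C b) (v b) + scale (C c) (v c)"
    using expand[OF abc(1,2)] by auto
  \<comment> \<open>\<open>D k\<close> is the coefficient of \<open>v k\<close> in the Jacobi sum of
    the three generators.\<close>
  define D where "D k = (A b - B a) * C k + (C a - A c) * B k + (B c - C b) * A k" for k
  \<comment> \<open>After expanding the inner bracket, one term vanishes by the alternating law, and
    skew-symmetry writes the others through the three cyclic brackets.\<close>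
  have nested:
    "bracket (v a) (bracket (v b) (v c)) = scale (A b) (bracket (v a) (v b)) - scale (A c) (bracket (v c) (v a))"
    "bracket (v b) (bracket (v c) (v a)) = scale (B c) (bracket (v b) (v c)) - scale (B a) (bracket (v a) (v b))"
    "bracket (v c) (bracket (v a) (v b)) = scale (C a) (bracket (v c) (v a)) - scale (C b) (bracket (v b) (v c))"
    by (subst A(3), simp add: bracket_add bracket_scale alternating bracket_skew[of "v a" "v c"])
      (subst B(3), simp add: bracket_add bracket_scale alternating bracket_skew[of "v b" "v a"],
        subst C(3), simp add: bracket_add bracket_scale alternating bracket_skew[of "v c" "v b"])
  have "scale (D a) (v a) + scale (D b) (v b) + scale (D c) (v c) =
      scale (A b - B a) (bracket (v a) (v b)) + scale (C a - A c) (bracket (v c) (v a)) +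
      scale (B c - C b) (bracket (v b) (v c))"
    unfolding A(3) B(3) C(3) D_def by (simp add: algebra_simps)
  also have "\<dots> = bracket (v a) (bracket (v b) (v c)) + bracket (v b) (bracket (v c) (v a)) +
      bracket (v c) (bracket (v a) (v b))"
    unfolding nested by (simp add: scale_left_diff_distrib)
  also have "\<dots> = 0" by (rule jacobi)
  finally have "(\<Sum>k\<in>G. scale (D k) (v k)) = (\<Sum>k\<in>G. 0)"
    using distinct by (simp add: G add.assoc)
  \<comment> \<open>Comparison with the zero family separates the homogeneous coordinates of the
    Jacobi sum.\<close>
  then have "scale (D k) (v k) = 0" if "k \<in> G" for k
    using that v
    by (intro decomposition_unique[of G "\<lambda>k. scale (D k) (v k)" "\<lambda>_. 0" k])
      (simp_all add: G subspace_V subspace_scale subspace_0)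
  then have "D k = 0" if "k \<in> {a, b, c}" for k
    using that v by (simp add: G)
  then have D: "(A b - B a) * C k + (C a - A c) * B k + (B c - C b) * A k = 0" if "k \<in> {a, b, c}" for k
    using that by (simp add: D_def)
  have no_square: "\<not> product_in g g k" if "g \<in> G" for g k
    using dim_ge_2_of_square[OF that, of k] dim1[OF that] by linarith
  have A_nonzero: "A k \<noteq> 0" if "k \<in> G" "product_in b c k \<or> product_in c b k" for k
    using coeffs[OF _ abc(2,3) that(1) A] product_in_sym that(2) by blast
  have B_nonzero: "B k \<noteq> 0" if "k \<in> G" "product_in c a k \<or> product_in a c k" for k
    using coeffs[OF _ abc(3,1) that(1) B] product_in_sym that(2) by blast
  have C_nonzero: "C k \<noteq> 0" if "k \<in> G" "product_in a b k \<or> product_in b a k" for k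
    using coeffs[OF _ abc(1,2) that(1) C] product_in_sym that(2) by blast
  show ?thesis
    unfolding G
  proof (rule semigroup_embeddable_three[OF distinct])
    show "{g, h} = {b, c} \<and> A k \<noteq> 0 \<or> {g, h} = {c, a} \<and> B k \<noteq> 0 \<or> {g, h} = {a, b} \<and> C k \<noteq> 0"
      if prod: "product_in g h k" and "g \<in> {a, b, c}" "h \<in> {a, b, c}" "k \<in> {a, b, c}" for g h k
    proof -
      have "k \<in> G" "g \<in> G" using that G by simp_all
      then have "g \<noteq> h" using no_square prod by blast
      then have "(g = b \<and> h = c \<or> g = c \<and> h = b) \<or> (g = c \<and> h = a \<or> g = a \<and> h = c) \<or>
          (g = a \<and> h = b \<or> g = b \<and> h = a)"
        using that(2,3) by blast
      then show ?thesis
        using A_nonzero[OF \<open>k \<in> G\<close>] B_nonzero[OF \<open>k \<in> G\<close>] C_nonzero[OF \<open>k \<in> G\<close>] prod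
        unfolding doubleton_eq_iff by blast
    qed
    have "p \<in> {a, b, c}" "q \<in> {a, b, c}" "r \<in> {a, b, c}"
      using A(1) B(1) C(1) unfolding G .
    moreover have "A k = 0" if "k \<noteq> p" for k using A(2) that by blast
    moreover have "B k = 0" if "k \<noteq> q" for k using B(2) that by blast
    moreover have "C k = 0" if "k \<noteq> r" for k using C(2) that by blast
    ultimately show "(\<exists>e. \<forall>k. k \<noteq> e \<longrightarrow> A k = 0 \<and> B k = 0 \<and> C k = 0) \<or>
      (\<forall>k. (k \<noteq> a \<longrightarrow> A k = 0) \<and> (k \<noteq> b \<longrightarrow> B k = 0) \<and> (k \<noteq> c \<longrightarrow> C k = 0)) \<or>
      (\<forall>k. (k \<noteq> a \<longrightarrow> A k = 0) \<and> (k \<noteq> c \<longrightarrow> B k = 0) \<and> (k \<noteq> b \<longrightarrow> C k = 0)) \<or>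
      (\<forall>k. (k \<noteq> c \<longrightarrow> A k = 0) \<and> (k \<noteq> b \<longrightarrow> B k = 0) \<and> (k \<noteq> a \<longrightarrow> C k = 0)) \<or>
      (\<forall>k. (k \<noteq> b \<longrightarrow> A k = 0) \<and> (k \<noteq> a \<longrightarrow> B k = 0) \<and> (k \<noteq> c \<longrightarrow> C k = 0))"
      using D by (intro jacobi_structure_constants[OF distinct, of p A q B r C])
  qed
qed

section \<open>The number of components and the conclusion\<close>

text \<open>Every component contributes at least 1 to the dimension. This bounds all finite subsets
  of \<open>G\<close> by \<open>n\<close>, from which finiteness of \<open>G\<close> itself
  follows.\<close>

lemma card_G_le:
  assumes "dim UNIV \<le> n"
  shows "finite G \<and> card G \<le> n"
proof -
  have "card F \<le> n" if "finite F" "F \<subseteq> G" for F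
  proof -
    have "card F = (\<Sum>g\<in>F. 1)" by simp
    also have "\<dots> \<le> (\<Sum>g\<in>F. dim (V g))"
      using dim_V_pos that(2) by (intro sum_mono) (auto simp: Suc_le_eq)
    also have "\<dots> \<le> n" using sum_dim_V_le[OF that] assms by simp
    finally show ?thesis .
  qed
  then show ?thesis by (intro finite_if_finite_subsets_card_bdd) blast
qed

theorem semigroup_embeddable_dim_le_3:
  assumes "dim UNIV \<le> 3"
  shows "semigroup_embeddable G product_in"
proof -
  have fin: "finite G" and "card G \<le> 3" using card_G_le[OF assms] by auto
  then consider "G = {}" | a where "G = {a}" | "card G = 2" | "card G = 3"
    by (metis card_0_eq card_1_singletonE le_Suc_eq le_zero_eq numeral_2_eq_2 numeral_3_eq_3 One_nat_def)
  then show ?thesis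
  proof cases
    case 1
    then show ?thesis by (intro semigroup_embeddable_constant) auto
  next
    case (2 a)
    \<comment> \<open>With a single component every nonzero product lands in it, so constant
      addition suffices.\<close>
    then show ?thesis by (intro semigroup_embeddable_constant[where e = a]) auto
  next
    case 3
    then obtain a b where "G = {a, b}" "a \<noteq> b" by (auto simp: card_2_iff)
    then show ?thesis using semigroup_embeddable_card_2 assms by blast
  next
    case 4
    then obtain a b c where "G = {a, b, c}" "a \<noteq> b" "a \<noteq> c" "b \<noteq> c" by (auto simp: card_3_iff)
    then show ?thesis using semigroup_embeddable_card_3 assms by blast
  qed
qed

end

(* The assumption on Basis expresses finite-dimensionality; the bound on dim alone would not,
   since dim is 0 in infinite dimension.

   HOL cannot quantify existentially over the type of the elements of the semigroup, so its
   carrier S is a subset of nat. This loses no generality: G is finite as the algebra is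
   finite-dimensional, so the subsemigroup generated by the image of G is countable and hence
   isomorphic to one carried by a subset of nat. *)
theorem mainTheorem2:
  fixes scale :: "'k::field \<Rightarrow> 'v::ab_group_add \<Rightarrow> 'v"
    and bracket :: "'v \<Rightarrow> 'v \<Rightarrow> 'v"
    and Basis :: "'v set"
    and G :: "'g set"
    and V :: "'g \<Rightarrow> 'v set"
  assumes "lie_algebra scale bracket"
    and "finite_dimensional_vector_space scale Basis"
    and "vector_space.dim scale UNIV \<le> 3"
    and "lie_algebra.lie_grading scale bracket G V"
  shows "\<exists>(S :: nat set) add \<iota>.
    abelian_semigroup_on S add \<and> \<iota> ` G \<subseteq> S \<and> inj_on \<iota> G \<and>
    (\<forall>g\<in>G. \<forall>g'\<in>G. \<forall>g''\<in>G.
       lie_algebra.bracket_span scale bracket (V g) (V g') \<noteq> {0} \<and>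
       lie_algebra.bracket_span scale bracket (V g) (V g') \<subseteq> V g'' \<longrightarrow>
       add (\<iota> g) (\<iota> g') = \<iota> g'')"
proof -
  interpret L: lie_algebra scale bracket by fact
  interpret F: finite_dimensional_vector_space scale Basis by fact
  interpret fd_lie_grading scale bracket Basis G V
    by unfold_locales (fact assms(4))
  show ?thesis
    using semigroup_embeddable_dim_le_3[OF assms(3)]
    unfolding semigroup_embeddable_def product_in_def .
qed

end
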